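(* Let $(X,s)$ be a real metrizable topological vector space with topological dual $X^*$, and let $d$ be a metric on $X$ compatible with $s$ such that $(X,d)$ is complete. Let $\mu^*$ be a linear topology on $X^*$ and let $\partial:\overline{\mathbb R}^{X}\times X\rightrightarrows X^*$ be a subdifferential (an arbitrary multifunction $(f,x)\mapsto\partial f(x)\subset X^*$) with the following property: if $h:X\to\overline{\mathbb R}$, $x_0$ is a local minimum point of $h$, and $h(x_0)\in\mathbb R$, then $0\in\partial h(x_0)$. Then, for every $x\in X$ and every $f\in S_{\mu^*}(\partial,x)$, $$\eth_d f(x)\subset s\times\mu^*\text{-}\operatorname{Limsup}_{y\to x}\partial f(y).$$
   Context: $\overline{\mathbb R}=[-\infty,+\infty]$. The duality product is $\langle x,x^*\rangle:=x^*(x)$. A metric $d$ on $X$ is compatible with $s$ if it generates the topology $s$ (no translation invariance is assumed). $\overline B_d(x;r):=\{y\in X\mid d(x,y)\le r\}$. Core subdifferential: for $f:X\to\overline{\mathbb R}$ and $x_0\in X$, $x_0^*\in X^*$ belongs to $\eth_d f(x_0)$ if $f(x_0)\in\mathbb R$ and there is a family $(\delta_\varepsilon)_{\varepsilon>0}\subset(0,+\infty)$ with $\limsup_{\varepsilon\downarrow0}\delta_\varepsilon/\varepsilon=+\infty$ such that $f(x_0)+\langle x-x_0,x_0^*\rangle\le f(x)+\varepsilon$ for every $\varepsilon>0$ and every $x\in\overline B_d(x_0;\delta_\varepsilon)$. If $f(x_0)\notin\mathbb R$, then $\eth_d f(x_0)=\emptyset$. Outer limit: for a topology $\tau$ on $X^*$,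 $x^*\in s\times\tau\text{-}\operatorname{Limsup}_{y\to x}\partial f(y)$ means that there is a net $((y_i,y_i^* ))_i$ with $y_i^*\in\partial f(y_i)$ for all $i$, $y_i\to x$ in $s$, $y_i^*\to x^*$ in $\tau$, and $f(y_i)\to f(x)$. The class $S_{\mu^*}(\partial,x)$: functionals $x^*\in X^*$ are identified with the functions $u\mapsto\langle u,x^*\rangle$ in sums such as $f+x^*$. $S_{\mu^*}(\partial,x)$ is the class of all $f:X\to\overline{\mathbb R}$ for which there exist a $\mu^*$-bounded set $M_{f,x}\subset X^*$ and a neighborhood $V_{f,x}$ of $x$ such that $f$ is lower semicontinuous on $V_{f,x}$ and, for all $y\in V_{f,x}$, $\lambda\ge0$, and $x^*\in X^*$, $$\partial\bigl(f+x^*+\lambda d(\cdot,y)\bigr)(y)\subset\partial f(y)+x^*+\lambda M_{f,x}.$$ *)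

theory Defs
  imports "HOL-Analysis.Analysis"
begin

text \<open>
  The space \<open>X\<close> is a type of sort \<open>real_vector\<close> with an explicit topology \<open>s\<close>. Its dual is a set of
  real functions, so vector operations on functionals are written pointwise. A linear topology is
  not required to be Hausdorff.
\<close>

definition linear_topology ::
    "'v set \<Rightarrow> ('v \<Rightarrow> 'v \<Rightarrow> 'v) \<Rightarrow> (real \<Rightarrow> 'v \<Rightarrow> 'v) \<Rightarrow> 'v topology \<Rightarrow> bool" where
  "linear_topology V pls scl \<tau> \<longleftrightarrow>
     topspace \<tau> = V \<and>
     continuous_map (prod_topology \<tau> \<tau>) \<tau> (\<lambda>(v, w). pls v w) \<and>
     continuous_map (prod_topology euclideanreal \<tau>) \<tau> (\<lambda>(t, v). scl t v)"

definition tvs :: "'a::real_vector topology \<Rightarrow> bool" where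
  "tvs s \<longleftrightarrow> linear_topology UNIV (+) (*\<^sub>R) s"

definition dual :: "'a::real_vector topology \<Rightarrow> ('a \<Rightarrow> real) set" where
  "dual s = {g. linear g \<and> continuous_map s euclideanreal g}"

definition linear_dual_topology ::
    "'a::real_vector topology \<Rightarrow> ('a \<Rightarrow> real) topology \<Rightarrow> bool" where
  "linear_dual_topology s \<mu> \<longleftrightarrow>
     linear_topology (dual s) (\<lambda>g h u. g u + h u) (\<lambda>t g u. t * g u) \<mu>"

definition dual_bounded ::
    "'a::real_vector topology \<Rightarrow> ('a \<Rightarrow> real) topology \<Rightarrow> ('a \<Rightarrow> real) set \<Rightarrow> bool" where
  "dual_bounded s \<mu> M \<longleftrightarrow>
     M \<subseteq> dual s \<and>
     (\<forall>U. openin \<mu> U \<and> (\<lambda>u. 0) \<in> U \<longrightarrow>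
        (\<exists>r>0. \<forall>t>r. M \<subseteq> (\<lambda>g u. t * g u) ` U))"

definition core_subdifferential ::
    "'a::real_vector topology \<Rightarrow> ('a \<Rightarrow> 'a \<Rightarrow> real) \<Rightarrow> ('a \<Rightarrow> ereal) \<Rightarrow> 'a \<Rightarrow> ('a \<Rightarrow> real) set" where
  "core_subdifferential s d f x0 =
     {xs \<in> dual s. \<bar>f x0\<bar> \<noteq> \<infinity> \<and>
        (\<exists>\<delta> :: real \<Rightarrow> real.
           (\<forall>\<epsilon>>0. \<delta> \<epsilon> > 0) \<and>
           Limsup (at_right 0) (\<lambda>\<epsilon>. ereal (\<delta> \<epsilon> / \<epsilon>)) = \<infinity> \<and>
           (\<forall>\<epsilon>>0. \<forall>x \<in> Metric_space.mcball UNIV d x0 (\<delta> \<epsilon>).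
              f x0 + ereal (xs (x - x0)) \<le> f x + ereal \<epsilon>))}"

definition directed_preorder :: "'i set \<Rightarrow> ('i \<Rightarrow> 'i \<Rightarrow> bool) \<Rightarrow> bool" where
  "directed_preorder I le \<longleftrightarrow>
     I \<noteq> {} \<and>
     (\<forall>i\<in>I. le i i) \<and>
     (\<forall>i\<in>I. \<forall>j\<in>I. \<forall>k\<in>I. le i j \<longrightarrow> le j k \<longrightarrow> le i k) \<and>
     (\<forall>i\<in>I. \<forall>j\<in>I. \<exists>k\<in>I. le i k \<and> le j k)"

definition net_converges ::
    "'b topology \<Rightarrow> 'i set \<Rightarrow> ('i \<Rightarrow> 'i \<Rightarrow> bool) \<Rightarrow> ('i \<Rightarrow> 'b) \<Rightarrow> 'b \<Rightarrow> bool" where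
  "net_converges \<tau> I le z p \<longleftrightarrow>
     p \<in> topspace \<tau> \<and>
     (\<forall>U. openin \<tau> U \<and> p \<in> U \<longrightarrow> (\<exists>i\<in>I. \<forall>j\<in>I. le i j \<longrightarrow> z j \<in> U))"

definition outer_net ::
    "'a topology \<Rightarrow> ('a \<Rightarrow> real) topology \<Rightarrow> ('a \<Rightarrow> ('a \<Rightarrow> real) set) \<Rightarrow> ('a \<Rightarrow> ereal) \<Rightarrow> 'a \<Rightarrow>
     ('a \<Rightarrow> real) \<Rightarrow> 'i set \<Rightarrow> ('i \<Rightarrow> 'i \<Rightarrow> bool) \<Rightarrow> ('i \<Rightarrow> 'a) \<Rightarrow> ('i \<Rightarrow> 'a \<Rightarrow> real) \<Rightarrow> bool" where
  "outer_net s \<tau> F f x xs I le y ys \<longleftrightarrow>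
     directed_preorder I le \<and>
     (\<forall>i\<in>I. ys i \<in> F (y i)) \<and>
     net_converges s I le y x \<and>
     net_converges \<tau> I le ys xs \<and>
     net_converges euclidean I le (\<lambda>i. f (y i)) (f x)"

text \<open>
  A definition cannot quantify over the index type of a net, so one sufficiently large type is
  fixed here. Lemma \<open>outer_net_imp_outer_limit\<close> shows that this loses no generality.
\<close>

definition outer_limit ::
    "'a topology \<Rightarrow> ('a \<Rightarrow> real) topology \<Rightarrow> ('a \<Rightarrow> ('a \<Rightarrow> real) set) \<Rightarrow> ('a \<Rightarrow> ereal) \<Rightarrow> 'a \<Rightarrow>
     ('a \<Rightarrow> real) set" where
  "outer_limit s \<tau> F f x =
     {xs. \<exists>(I :: ('a \<times> ('a \<Rightarrow> real) \<times> ereal) set set) le y ys. outer_net s \<tau> F f x xs I le y ys}"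

lemma outer_net_imp_outer_limit:
  fixes I :: "'i set"
  assumes "outer_net s \<tau> F f x xs I le y ys"
  shows "xs \<in> outer_limit s \<tau> F f x"
proof -
  define J where "J = {U \<times> V \<times> W | U V W.
    openin s U \<and> x \<in> U \<and> openin \<tau> V \<and> xs \<in> V \<and> open W \<and> f x \<in> W}"
  define le' where "le' N N' \<longleftrightarrow> N' \<subseteq> N" for N N' :: "('a \<times> ('a \<Rightarrow> real) \<times> ereal) set"
  have dir: "directed_preorder I le" and mem: "\<And>i. i \<in> I \<Longrightarrow> ys i \<in> F (y i)"
    and cy: "net_converges s I le y x" and cys: "net_converges \<tau> I le ys xs"
    and cf: "net_converges euclidean I le (\<lambda>i. f (y i)) (f x)"
    using assms by (auto simp: outer_net_def)
  have up: "\<exists>k\<in>I. le i k \<and> le j k" if "i \<in> I" "j \<in> I" for i j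
    using dir that unfolding directed_preorder_def by blast
  have tr: "le i k" if "i \<in> I" "j \<in> I" "k \<in> I" "le i j" "le j k" for i j k
    using dir that unfolding directed_preorder_def by blast
  have ex: "\<exists>i\<in>I. (y i, ys i, f (y i)) \<in> N" if N: "N \<in> J" for N
  proof -
    obtain U V W where N: "N = U \<times> V \<times> W" and o: "openin s U" "x \<in> U" "openin \<tau> V" "xs \<in> V"
      "openin euclidean W" "f x \<in> W"
      using N unfolding J_def by auto
    obtain a where a: "a \<in> I" "\<And>j. j \<in> I \<Longrightarrow> le a j \<Longrightarrow> y j \<in> U"
      using cy o(1,2) unfolding net_converges_def by blast
    obtain b where b: "b \<in> I" "\<And>j. j \<in> I \<Longrightarrow> le b j \<Longrightarrow> ys j \<in> V"
      using cys o(3,4) unfolding net_converges_def by blast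
    obtain c where c: "c \<in> I" "\<And>j. j \<in> I \<Longrightarrow> le c j \<Longrightarrow> f (y j) \<in> W"
      using cf o(5,6) unfolding net_converges_def by blast
    obtain k where k: "k \<in> I" "le a k" "le b k" using up[OF a(1) b(1)] by blast
    obtain m where m: "m \<in> I" "le k m" "le c m" using up[OF k(1) c(1)] by blast
    have "le a m" "le b m" using tr[of a k m] tr[of b k m] a(1) b(1) k m by simp_all
    then have "(y m, ys m, f (y m)) \<in> N" using a(2) b(2) c(2) m unfolding N by simp
    then show ?thesis using m(1) by (rule bexI)
  qed
  then obtain p where p: "\<And>N. N \<in> J \<Longrightarrow> p N \<in> I \<and> (y (p N), ys (p N), f (y (p N))) \<in> N"
    unfolding Bex_def by metis
  have pN: "(y (p N'), ys (p N'), f (y (p N'))) \<in> N" if "N' \<in> J" "N' \<subseteq> N" for N N'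
    using p[OF that(1)] that(2) by (intro subsetD[OF that(2)]) simp
  have top: "x \<in> topspace s" "xs \<in> topspace \<tau>"
    using cy cys by (auto simp: net_converges_def)
  have inJ: "U \<times> V \<times> W \<in> J" if "openin s U" "x \<in> U" "openin \<tau> V" "xs \<in> V" "open W" "f x \<in> W"
    for U V W
    unfolding J_def using that by (intro CollectI exI[of _ U] exI[of _ V] exI[of _ W]) simp
  have inter: "N \<inter> N' \<in> J" if NN: "N \<in> J" "N' \<in> J" for N N'
  proof -
    obtain U V W where 1: "N = U \<times> V \<times> W" "openin s U" "x \<in> U" "openin \<tau> V" "xs \<in> V"
        "open W" "f x \<in> W"
      using NN(1) unfolding J_def by auto
    obtain U' V' W' where 2: "N' = U' \<times> V' \<times> W'" "openin s U'" "x \<in> U'" "openin \<tau> V'"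
        "xs \<in> V'" "open W'" "f x \<in> W'"
      using NN(2) unfolding J_def by auto
    have "(U \<inter> U') \<times> (V \<inter> V') \<times> (W \<inter> W') \<in> J"
      using 1 2 by (intro inJ openin_Int open_Int IntI)
    then show ?thesis
      unfolding 1(1) 2(1) by (simp only: Times_Int_Times)
  qed
  have ne: "topspace s \<times> topspace \<tau> \<times> UNIV \<in> J"
    using top by (intro inJ) auto
  have "\<exists>K\<in>J. K \<subseteq> N \<and> K \<subseteq> N'" if "N \<in> J" "N' \<in> J" for N N'
    by (rule bexI[OF _ inter[OF that]]) simp
  then have "directed_preorder J le'"
    using ne unfolding directed_preorder_def le'_def by auto
  moreover have "net_converges s J le' (\<lambda>N. y (p N)) x"
    unfolding net_converges_def
  proof (intro conjI allI impI)
    fix U assume "openin s U \<and> x \<in> U"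
    then have N: "U \<times> topspace \<tau> \<times> UNIV \<in> J" using top by (intro inJ) auto
    show "\<exists>N\<in>J. \<forall>N'\<in>J. le' N N' \<longrightarrow> y (p N') \<in> U"
      by (rule bexI[OF _ N]) (auto simp: le'_def dest!: pN)
  qed (rule top)
  moreover have "net_converges \<tau> J le' (\<lambda>N. ys (p N)) xs"
    unfolding net_converges_def
  proof (intro conjI allI impI)
    fix V assume "openin \<tau> V \<and> xs \<in> V"
    then have N: "topspace s \<times> V \<times> UNIV \<in> J" using top by (intro inJ) auto
    show "\<exists>N\<in>J. \<forall>N'\<in>J. le' N N' \<longrightarrow> ys (p N') \<in> V"
      by (rule bexI[OF _ N]) (auto simp: le'_def dest!: pN)
  qed (rule top)
  moreover have "net_converges euclidean J le' (\<lambda>N. f (y (p N))) (f x)"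
    unfolding net_converges_def
  proof (intro conjI allI impI)
    fix W :: "ereal set" assume "openin euclidean W \<and> f x \<in> W"
    then have N: "topspace s \<times> topspace \<tau> \<times> W \<in> J" using top by (intro inJ) auto
    show "\<exists>N\<in>J. \<forall>N'\<in>J. le' N N' \<longrightarrow> f (y (p N')) \<in> W"
      by (rule bexI[OF _ N]) (auto simp: le'_def dest!: pN)
  qed simp
  moreover have "\<forall>N\<in>J. ys (p N) \<in> F (y (p N))"
    using p mem by blast
  ultimately have "outer_net s \<tau> F f x xs J le' (\<lambda>N. y (p N)) (\<lambda>N. ys (p N))"
    unfolding outer_net_def by (intro conjI)
  then show ?thesis
    unfolding outer_limit_def by blast
qed

definition lsc_at :: "'a topology \<Rightarrow> ('a \<Rightarrow> ereal) \<Rightarrow> 'a \<Rightarrow> bool" where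
  "lsc_at s f y \<longleftrightarrow> (\<forall>c < f y. \<exists>U. openin s U \<and> y \<in> U \<and> (\<forall>u\<in>U. c < f u))"

definition local_minimum_at :: "'a topology \<Rightarrow> ('a \<Rightarrow> ereal) \<Rightarrow> 'a \<Rightarrow> bool" where
  "local_minimum_at s h x0 \<longleftrightarrow> (\<exists>U. openin s U \<and> x0 \<in> U \<and> (\<forall>u\<in>U. h x0 \<le> h u))"

definition S_class ::
    "'a::real_vector topology \<Rightarrow> ('a \<Rightarrow> 'a \<Rightarrow> real) \<Rightarrow> ('a \<Rightarrow> real) topology \<Rightarrow>
     (('a \<Rightarrow> ereal) \<Rightarrow> 'a \<Rightarrow> ('a \<Rightarrow> real) set) \<Rightarrow> 'a \<Rightarrow> ('a \<Rightarrow> ereal) set" where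
  "S_class s d \<mu> subdiff x =
     {f. \<exists>M V. dual_bounded s \<mu> M \<and>
           (\<exists>U. openin s U \<and> x \<in> U \<and> U \<subseteq> V) \<and>
           (\<forall>y\<in>V. lsc_at s f y) \<and>
           (\<forall>y\<in>V. \<forall>t\<ge>0. \<forall>xs\<in>dual s.
              subdiff (\<lambda>u. f u + ereal (xs u) + ereal (t * d u y)) y
                \<subseteq> {\<lambda>u. g u + xs u + t * m u | g m. g \<in> subdiff f y \<and> m \<in> M})}"

end

theory Submission
  imports Defs
begin

text \<open>
  The idea is to turn an approximate minimum into an exact one. If \<open>xs\<close> lies in the core
  subdifferential of \<open>f\<close> at \<open>x\<close>, then \<open>x\<close> minimizes \<open>f - xs\<close> up to \<open>\<epsilon>\<close> on a ball of radius \<open>\<delta>\<close>, and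
  \<open>\<epsilon> / \<delta>\<close> can be made as small as desired. Ekeland's variational principle
  (\<open>ekeland_variational_principle\<close>), applied on that complete ball with a slope \<open>t > \<epsilon> / \<delta>\<close>, yields a
  point \<open>y\<close> that minimizes \<open>f - xs + t d(\<cdot>, y)\<close> over the ball. The slope exceeds \<open>\<epsilon> / \<delta>\<close>, and so
  \<open>d(x, y) \<le> \<epsilon> / t < \<delta>\<close>: the point \<open>y\<close> is interior, hence a local minimum on the whole space. The
  axiom of the subdifferential gives \<open>0 \<in> \<partial>(f - xs + t d(\<cdot>, y))(y)\<close>, and membership in the class
  \<open>S\<close> rewrites this as \<open>xs - t m \<in> \<partial>f(y)\<close> with \<open>m\<close> in a fixed bounded set
  (\<open>subgradient_near_core_subgradient\<close>).

  Along \<open>t \<rightarrow> 0\<close> the points \<open>y\<close> tend to \<open>x\<close>, and the values \<open>f y\<close> tend to \<open>f x\<close> because \<open>f - xs\<close>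
  varies by at most \<open>\<epsilon>\<close> between \<open>x\<close> and \<open>y\<close>. The subgradients tend to \<open>xs\<close> because a bounded set is
  absorbed by every neighbourhood of zero (\<open>small_multiples_of_bounded_stay_near\<close>). A sequence
  therefore suffices, although the outer limit is defined by nets.
\<close>

section \<open>Ekeland's variational principle\<close>

text \<open>
  The relation \<open>\<phi> u + c * d y u \<le> \<phi> y\<close> is a partial order on \<open>C\<close>, and the claim is that some
  element below \<open>x\<close> is minimal. A descending sequence that nearly exhausts the possible decrease of
  \<open>\<phi>\<close> at each step is Cauchy, since its distances are controlled by the decrease of \<open>\<phi>\<close>, and its
  limit is minimal. Closedness of \<open>C\<close> and semicontinuity enter only through \<open>lim\<close>, along sequences
  on which \<open>\<phi>\<close> decreases.
\<close>

lemma (in Metric_space) ekeland_real: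
  fixes \<phi> :: "'a \<Rightarrow> real"
  assumes complete: mcomplete and C: "C \<subseteq> M" "x \<in> C" and c: "c > 0"
    and below: "\<And>u. u \<in> C \<Longrightarrow> b \<le> \<phi> u"
    and lim: "\<And>z l. range z \<subseteq> C \<Longrightarrow> decseq (\<lambda>n. \<phi> (z n)) \<Longrightarrow> limitin mtopology z l sequentially
                \<Longrightarrow> l \<in> C \<and> (\<forall>n. \<phi> l \<le> \<phi> (z n))"
  shows "\<exists>y\<in>C. \<phi> y + c * d x y \<le> \<phi> x \<and> (\<forall>u\<in>C. u \<noteq> y \<longrightarrow> \<phi> y < \<phi> u + c * d y u)"
proof -
  define S where "S y = {u \<in> C. \<phi> u + c * d y u \<le> \<phi> y}" for y
  have S_refl: "y \<in> S y" if "y \<in> C" for y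
    using that C by (auto simp: S_def)
  have S_trans: "v \<in> S y" if "y \<in> C" "u \<in> S y" "v \<in> S u" for y u v
  proof -
    have "d y v \<le> d y u + d u v"
      using that C by (intro triangle) (auto simp: S_def)
    then have "c * d y v \<le> c * d y u + c * d u v"
      using c by (simp flip: distrib_left)
    then show ?thesis using that by (auto simp: S_def)
  qed
  have next_step: "\<exists>v \<in> S y. \<forall>u \<in> S y. \<phi> v \<le> \<phi> u + (1/2)^n" if "y \<in> C" for y and n :: nat
  proof -
    have bdd: "bdd_below (\<phi> ` S y)"
      using below by (intro bdd_belowI2[of _ b]) (auto simp: S_def)
    have "\<exists>a\<in>\<phi> ` S y. a < Inf (\<phi> ` S y) + (1/2)^n"
      using S_refl[OF that] by (intro cInf_lessD) auto
    then obtain v where v: "v \<in> S y" "\<phi> v < Inf (\<phi> ` S y) + (1/2)^n" by auto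
    have "Inf (\<phi> ` S y) \<le> \<phi> u" if "u \<in> S y" for u
      using bdd that by (intro cInf_lower) auto
    then show ?thesis using v by force
  qed
  have "\<exists>z. \<forall>n. (z n \<in> C \<and> (n = 0 \<longrightarrow> z n = x)) \<and>
      (z (Suc n) \<in> S (z n) \<and> (\<forall>u \<in> S (z n). \<phi> (z (Suc n)) \<le> \<phi> u + (1/2)^n))"
  proof (rule dependent_nat_choice)
    show "\<exists>y. y \<in> C \<and> (0 = 0 \<longrightarrow> y = x)" using C by blast
    show "\<exists>v. (v \<in> C \<and> (Suc n = 0 \<longrightarrow> v = x)) \<and>
        (v \<in> S y \<and> (\<forall>u \<in> S y. \<phi> v \<le> \<phi> u + (1/2)^n))"
      if "y \<in> C \<and> (n = 0 \<longrightarrow> y = x)" for y and n :: nat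
      using next_step[of y n] that by (auto simp: S_def)
  qed
  then obtain z where z0: "z 0 = x" and zC: "\<And>n. z n \<in> C" and zS: "\<And>n. z (Suc n) \<in> S (z n)"
    and near_inf: "\<And>n u. u \<in> S (z n) \<Longrightarrow> \<phi> (z (Suc n)) \<le> \<phi> u + (1/2)^n" by blast
  have zM: "z n \<in> M" for n using zC C by auto
  have chain: "z m \<in> S (z n)" if "n \<le> m" for n m
    using that
  proof (induction m rule: dec_induct)
    case base
    show ?case by (rule S_refl[OF zC])
  next
    case (step m)
    show ?case by (rule S_trans[OF zC step.IH zS])
  qed
  have dist: "c * d (z n) (z m) \<le> \<phi> (z n) - \<phi> (z m)" if "n \<le> m" for n m
    using chain[OF that] by (auto simp: S_def)
  have dec: "decseq (\<lambda>n. \<phi> (z n))"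
  proof (rule decseq_SucI)
    show "\<phi> (z (Suc n)) \<le> \<phi> (z n)" for n
      using dist[of n "Suc n"] mult_nonneg_nonneg[OF less_imp_le[OF c] nonneg, of "z n" "z (Suc n)"]
      by linarith
  qed
  have cauchy: "MCauchy z"
    unfolding MCauchy_def
  proof (intro conjI allI impI)
    show "range z \<subseteq> M" using zM by auto
    fix e :: real assume e: "e > 0"
    have "convergent (\<lambda>n. \<phi> (z n))"
      using decseq_convergent[OF dec] below[OF zC] by (metis convergentI)
    then have "Cauchy (\<lambda>n. \<phi> (z n))" by (rule convergent_Cauchy)
    then obtain K where K: "\<And>m n. m \<ge> K \<Longrightarrow> n \<ge> K \<Longrightarrow> norm (\<phi> (z m) - \<phi> (z n)) < c * e"
      using c e by (meson CauchyD mult_pos_pos)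
    have less: "d (z n) (z m) < e" if "K \<le> n" "n \<le> m" for n m
    proof -
      have "c * d (z n) (z m) < c * e"
        using dist[OF that(2)] K[of n m] that by auto
      then show ?thesis using c by simp
    qed
    then show "\<exists>N. \<forall>n n'. N \<le> n \<longrightarrow> N \<le> n' \<longrightarrow> d (z n) (z n') < e"
      by (intro exI[of _ K]) (metis commute nle_le)
  qed
  then obtain l where l: "limitin mtopology z l sequentially"
    using complete unfolding mcomplete_def by blast
  have lC: "l \<in> C" and l_le: "\<And>n. \<phi> l \<le> \<phi> (z n)"
    using lim[of z l] l dec zC by auto
  have lM: "l \<in> M" using lC C by auto
  have tends: "(\<lambda>m. d (z m) l) \<longlonglongrightarrow> 0"
    using l limitin_metric_dist_null by blast
  \<comment> \<open>Let \<open>m\<close> tend to infinity in the bound on \<open>d (z n) (z m)\<close>.\<close>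
  have l_below: "l \<in> S (z n)" for n
  proof -
    have "eventually (\<lambda>m. c * d (z n) l \<le> \<phi> (z n) - \<phi> l + c * d (z m) l) sequentially"
      using eventually_ge_at_top[of n]
    proof eventually_elim
      case (elim m)
      have "c * d (z n) l \<le> c * (d (z n) (z m) + d (z m) l)"
        using c triangle[OF zM[of n] zM[of m] lM] by simp
      then show ?case using dist[OF elim] l_le[of m] by (simp add: distrib_left)
    qed
    moreover have "(\<lambda>m. \<phi> (z n) - \<phi> l + c * d (z m) l) \<longlonglongrightarrow> \<phi> (z n) - \<phi> l + c * 0"
      by (intro tendsto_intros tends)
    ultimately have "c * d (z n) l \<le> \<phi> (z n) - \<phi> l"
      using tendsto_lowerbound[of "\<lambda>m. \<phi> (z n) - \<phi> l + c * d (z m) l"] by simp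
    then show ?thesis using lC by (simp add: S_def)
  qed
  \<comment> \<open>A point below \<open>l\<close> is below every \<open>z n\<close>, so \<open>\<phi>\<close> cannot drop by more than \<open>(1/2)^n\<close> from \<open>l\<close> to it.\<close>
  have minimal: "u = l" if u: "u \<in> S l" for u
  proof -
    have "c * d l u \<le> (1/2)^n" for n
      using near_inf[OF S_trans[OF zC[of n] l_below u]] l_le[of "Suc n"] u by (auto simp: S_def)
    then have "c * d l u \<le> 0"
      by (intro tendsto_lowerbound[OF LIMSEQ_power_zero[of "1/2::real"]]) auto
    then have "d l u = 0" using c by (simp add: mult_le_0_iff order_antisym)
    then show ?thesis using lM u C by (auto simp: S_def)
  qed
  have "\<phi> l + c * d x l \<le> \<phi> x" using l_below[of 0] z0 by (auto simp: S_def)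
  moreover have "\<phi> l < \<phi> u + c * d l u" if "u \<in> C" "u \<noteq> l" for u
    using minimal[of u] that by (force simp: S_def)
  ultimately show ?thesis using lC by blast
qed

text \<open>
  An extended real function is reduced to a real one on the sublevel set of \<open>x\<close>, where it is finite;
  points with a larger value satisfy the strict inequality trivially.
\<close>

lemma (in Metric_space) ekeland_variational_principle:
  fixes h :: "'a \<Rightarrow> ereal"
  assumes complete: mcomplete and K: "closedin mtopology K" "x \<in> K" and c: "c > 0"
    and lsc: "\<And>y. y \<in> K \<Longrightarrow> lsc_at mtopology h y"
    and fin: "\<bar>h x\<bar> \<noteq> \<infinity>" and below: "\<And>u. u \<in> K \<Longrightarrow> ereal b \<le> h u"
  shows "\<exists>y\<in>K. h y + ereal (c * d x y) \<le> h x \<and>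
           (\<forall>u\<in>K. u \<noteq> y \<longrightarrow> h y < h u + ereal (c * d y u))"
proof -
  define C where "C = {u \<in> K. h u \<le> h x}"
  define \<phi> where "\<phi> u = real_of_ereal (h u)" for u
  have KM: "K \<subseteq> M" using closedin_subset[OF K(1)] by simp
  have h: "h u = ereal (\<phi> u)" if "u \<in> C" for u
  proof -
    have "h u \<noteq> \<infinity>" "h u \<noteq> -\<infinity>" using that below[of u] fin by (auto simp: C_def)
    then show ?thesis by (cases "h u") (auto simp: \<phi>_def)
  qed
  have xC: "x \<in> C" using K by (simp add: C_def)
  have "\<exists>y\<in>C. \<phi> y + c * d x y \<le> \<phi> x \<and> (\<forall>u\<in>C. u \<noteq> y \<longrightarrow> \<phi> y < \<phi> u + c * d y u)"
  proof (rule ekeland_real[OF complete])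
    show "C \<subseteq> M" "x \<in> C" "c > 0" using KM xC c by (auto simp: C_def)
    show "b \<le> \<phi> u" if "u \<in> C" for u
      using below[of u] h[OF that] that by (auto simp: C_def)
    fix z l
    assume z: "range z \<subseteq> C" "decseq (\<lambda>n. \<phi> (z n))" "limitin mtopology z l sequentially"
    have zC: "z n \<in> C" for n using z(1) by auto
    have lK: "l \<in> K"
      using limitin_closedin[OF z(3) K(1)] zC by (auto simp: C_def)
    have le: "h l \<le> h (z n)" for n
    proof (rule ccontr)
      assume "\<not> ?thesis"
      then obtain U where U: "openin mtopology U" "l \<in> U" "\<And>u. u \<in> U \<Longrightarrow> h (z n) < h u"
        using lsc[OF lK] unfolding lsc_at_def by (metis not_le)
      have "eventually (\<lambda>m. z m \<in> U) sequentially"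
        using z(3) U by (simp add: limitin_def)
      then obtain m where "m \<ge> n" "z m \<in> U"
        unfolding eventually_sequentially by (metis nle_le)
      then show False
        using U(3)[of "z m"] decseqD[OF z(2), of n m] h[OF zC] by auto
    qed
    have "l \<in> C" using lK le[of 0] zC[of 0] by (auto simp: C_def)
    then show "l \<in> C \<and> (\<forall>n. \<phi> l \<le> \<phi> (z n))"
      using le h zC by (metis ereal_less_eq(3))
  qed
  then obtain y where y: "y \<in> C" "\<phi> y + c * d x y \<le> \<phi> x"
    "\<And>u. u \<in> C \<Longrightarrow> u \<noteq> y \<Longrightarrow> \<phi> y < \<phi> u + c * d y u" by blast
  have "h y < h u + ereal (c * d y u)" if "u \<in> K" "u \<noteq> y" for u
  proof (cases "u \<in> C")
    case True
    then show ?thesis using y(1) y(3)[OF True that(2)] h by simp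
  next
    case False
    then have "h y < h u" using that y(1) by (auto simp: C_def)
    also have "\<dots> \<le> h u + ereal (c * d y u)"
      using c by (intro ereal_le_add_self) simp
    finally show ?thesis .
  qed
  moreover have "h y + ereal (c * d x y) \<le> h x"
    using y(2) h[OF y(1)] h[OF xC] by simp
  moreover have "y \<in> K" using y(1) by (simp add: C_def)
  ultimately show ?thesis by blast
qed

section \<open>Bounded sets and semicontinuity in topological vector spaces\<close>

lemma small_multiples_of_bounded_stay_near:
  assumes lin: "linear_dual_topology s \<mu>" and bdd: "dual_bounded s \<mu> M"
    and U: "openin \<mu> U" "xs \<in> U"
  shows "\<exists>\<tau>>0. \<forall>t. 0 < t \<and> t < \<tau> \<longrightarrow> (\<forall>m\<in>M. (\<lambda>u. xs u - t * m u) \<in> U)"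
proof -
  have top: "topspace \<mu> = dual s"
    and add: "continuous_map (prod_topology \<mu> \<mu>) \<mu> (\<lambda>(g, h). (\<lambda>u. g u + h u))"
    and scl: "continuous_map (prod_topology euclideanreal \<mu>) \<mu> (\<lambda>(t, g). (\<lambda>u. t * g u))"
    using lin unfolding linear_dual_topology_def linear_topology_def by auto
  have xs: "xs \<in> topspace \<mu>" using openin_subset[OF U(1)] U(2) by auto
  have neg: "continuous_map \<mu> \<mu> (\<lambda>g u. -1 * g u)"
    using continuous_map_compose[OF _ scl, of \<mu> "\<lambda>g. (-1, g)"]
    by (simp add: o_def continuous_map_pairedI)
  have shift: "continuous_map \<mu> \<mu> (\<lambda>g u. xs u + (-1 * g u))"
    using continuous_map_compose[OF _ add, of \<mu> "\<lambda>g. (xs, \<lambda>u. -1 * g u)"] neg xs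
    by (simp add: o_def continuous_map_pairedI)
  define W where "W = {g \<in> topspace \<mu>. (\<lambda>u. xs u + (-1 * g u)) \<in> U}"
  have W: "openin \<mu> W"
    unfolding W_def using shift U(1) by (rule openin_continuous_map_preimage)
  have "(\<lambda>u. 0) \<in> dual s" by (simp add: dual_def linear_zero)
  then have "(\<lambda>u. 0) \<in> W" using U by (simp add: W_def top)
  then obtain r where r: "r > 0" "\<And>t. t > r \<Longrightarrow> M \<subseteq> (\<lambda>g u. t * g u) ` W"
    using bdd W unfolding dual_bounded_def by blast
  have "(\<lambda>u. xs u - t * m u) \<in> U" if t: "0 < t" "t < 1 / r" and m: "m \<in> M" for t m
  proof -
    have "1 / t > r" using t r(1) by (simp add: field_simps)
    then obtain g where g: "g \<in> W" "m = (\<lambda>u. 1 / t * g u)" using r(2) m by blast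
    have "(\<lambda>u. xs u - t * m u) = (\<lambda>u. xs u + (-1 * g u))"
      using t g(2) by (auto simp: fun_eq_iff)
    then show ?thesis using g(1) by (simp add: W_def)
  qed
  then show ?thesis using r(1) by (intro exI[of _ "1 / r"]) auto
qed

lemma uminus_in_dual:
  assumes "xs \<in> dual s"
  shows "(\<lambda>u. - xs u) \<in> dual s"
  using assms unfolding dual_def mem_Collect_eq
  by (elim conjE) (intro conjI linear_compose_neg continuous_map_minus)

lemma lsc_at_diff_continuous:
  assumes lsc: "lsc_at s f y" and cont: "continuous_map s euclideanreal g" and y: "y \<in> topspace s"
  shows "lsc_at s (\<lambda>u. f u + ereal (- g u)) y"
  unfolding lsc_at_def
proof (intro allI impI)
  fix c assume c: "c < f y + ereal (- g y)"
  obtain q where q: "c < ereal q" "ereal q < f y + ereal (- g y)"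
    using c by (meson ereal_dense2)
  then have "ereal (q + g y) < f y" by (cases "f y") auto
  then obtain p where p: "ereal (q + g y) < ereal p" "ereal p < f y" by (meson ereal_dense2)
  obtain U where U: "openin s U" "y \<in> U" "\<And>u. u \<in> U \<Longrightarrow> ereal p < f u"
    using lsc p(2) unfolding lsc_at_def by meson
  \<comment> \<open>The gap between \<open>q + g y\<close> and \<open>f y\<close> is split at \<open>p\<close>: one part for \<open>f\<close>, the other for \<open>g\<close>.\<close>
  define W where "W = {u \<in> topspace s. g u \<in> {..< p - q}}"
  have "openin s W"
    unfolding W_def by (rule openin_continuous_map_preimage[OF cont]) simp
  moreover have "y \<in> W" using p y by (simp add: W_def)
  moreover have "c < f u + ereal (- g u)" if "u \<in> U \<inter> W" for u
  proof -
    have "ereal p < f u" "q < p - g u" using that U(3) by (auto simp: W_def)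
    then have "ereal q < f u + ereal (- g u)" by (cases "f u") auto
    then show ?thesis using q(1) by (rule less_trans[rotated])
  qed
  ultimately show "\<exists>U. openin s U \<and> y \<in> U \<and> (\<forall>u\<in>U. c < f u + ereal (- g u))"
    using U by (intro exI[of _ "U \<inter> W"]) auto
qed

section \<open>Subgradients near a core subgradient\<close>

text \<open>
  Shrinking a ball preserves the core inequality, and so \<open>\<delta>\<close> may be taken below any prescribed radius
  \<open>r\<close>; the ratio \<open>\<epsilon> / \<delta>\<close> stays below \<open>t\<close> if in addition \<open>\<epsilon> < t * r\<close>.
\<close>

lemma core_subdifferential_small_ratio:
  assumes xs: "xs \<in> core_subdifferential s d f x" and d: "Metric_space UNIV d"
    and t: "t > 0" and r: "r > 0"
  shows "\<exists>\<epsilon> \<delta>. 0 < \<epsilon> \<and> \<epsilon> < t \<and> 0 < \<delta> \<and> \<delta> \<le> r \<and> \<epsilon> < t * \<delta> \<and>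
           (\<forall>u. d x u \<le> \<delta> \<longrightarrow> f x + ereal (xs (u - x)) \<le> f u + ereal \<epsilon>)"
proof -
  interpret Metric_space UNIV d by (rule d)
  obtain \<delta> :: "real \<Rightarrow> real" where \<delta>: "\<And>\<epsilon>. \<epsilon> > 0 \<Longrightarrow> \<delta> \<epsilon> > 0"
    and sup: "Limsup (at_right 0) (\<lambda>\<epsilon>. ereal (\<delta> \<epsilon> / \<epsilon>)) = \<infinity>"
    and le: "\<And>\<epsilon> u. \<epsilon> > 0 \<Longrightarrow> d x u \<le> \<delta> \<epsilon> \<Longrightarrow> f x + ereal (xs (u - x)) \<le> f u + ereal \<epsilon>"
    using xs unfolding core_subdifferential_def by (auto simp: mcball_def)
  \<comment> \<open>A bound \<open>1 / t\<close> on the ratio for all small \<open>\<epsilon>\<close> would bound the upper limit.\<close>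
  have "\<not> eventually (\<lambda>\<epsilon>. ereal (\<delta> \<epsilon> / \<epsilon>) \<le> ereal (1 / t)) (at_right 0)"
    using Limsup_bounded[of "\<lambda>\<epsilon>. ereal (\<delta> \<epsilon> / \<epsilon>)" "ereal (1 / t)" "at_right 0"] sup by auto
  moreover have "eventually (\<lambda>\<epsilon>. 0 < \<epsilon> \<and> \<epsilon> < min t (t * r)) (at_right (0::real))"
    using eventually_at_right_real[of 0 "min t (t * r)"] t r by simp
  ultimately have "\<exists>\<epsilon>. 0 < \<epsilon> \<and> \<epsilon> < min t (t * r) \<and> \<delta> \<epsilon> / \<epsilon> > 1 / t"
    by (metis (mono_tags, lifting) eventually_mono ereal_less_eq(3) not_le)
  then obtain \<epsilon> where \<epsilon>: "0 < \<epsilon>" "\<epsilon> < t" "\<epsilon> < t * r" "\<delta> \<epsilon> / \<epsilon> > 1 / t" by auto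
  have "\<epsilon> < t * \<delta> \<epsilon>" using \<epsilon> t by (simp add: field_simps)
  then have "\<epsilon> < t * min (\<delta> \<epsilon>) r" using \<epsilon> by (simp add: min_def)
  then show ?thesis
    using \<epsilon> \<delta>[OF \<epsilon>(1)] r le[OF \<epsilon>(1)] by (intro exI[of _ \<epsilon>] exI[of _ "min (\<delta> \<epsilon>) r"]) auto
qed

text \<open>
  The point where Ekeland's principle meets the subdifferential: a core subgradient \<open>xs\<close> at \<open>x\<close>
  differs by \<open>t\<close> times a member of \<open>M\<close> from a genuine subgradient at a nearby point. The minimizer
  \<open>y\<close> of the perturbed function over the ball is interior since \<open>t * d x y \<le> \<epsilon> < t * \<delta>\<close>. The last
  conjunct gives \<open>f y \<rightarrow> f x\<close> as \<open>t\<close> and \<open>r\<close> tend to zero.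
\<close>

lemma subgradient_near_core_subgradient:
  fixes s :: "'a::real_vector topology"
  assumes d: "Metric_space UNIV d" and s: "Metric_space.mtopology UNIV d = s"
    and complete: "Metric_space.mcomplete UNIV d"
    and fermat: "\<And>h x0. local_minimum_at s h x0 \<Longrightarrow> \<bar>h x0\<bar> \<noteq> \<infinity> \<Longrightarrow> (\<lambda>u. 0) \<in> subdiff h x0"
    and xs: "xs \<in> core_subdifferential s d f x"
    and t: "t > 0" and r: "r > 0"
    and lsc: "\<And>y. d x y \<le> r \<Longrightarrow> lsc_at s f y"
    and perturb: "\<And>y zs. d x y \<le> r \<Longrightarrow> zs \<in> dual s \<Longrightarrow>
        subdiff (\<lambda>u. f u + ereal (zs u) + ereal (t * d u y)) y
          \<subseteq> {\<lambda>u. g u + zs u + t * m u | g m. g \<in> subdiff f y \<and> m \<in> M}"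
  shows "\<exists>y m. d x y < r \<and> m \<in> M \<and> (\<lambda>u. xs u - t * m u) \<in> subdiff f y \<and>
           \<bar>f x\<bar> \<noteq> \<infinity> \<and> \<bar>f y\<bar> \<noteq> \<infinity> \<and>
           \<bar>real_of_ereal (f y) - (real_of_ereal (f x) + xs (y - x))\<bar> \<le> t"
proof -
  interpret Metric_space UNIV d by (rule d)
  obtain \<epsilon> \<delta> where \<epsilon>: "0 < \<epsilon>" "\<epsilon> < t" and \<delta>: "0 < \<delta>" "\<delta> \<le> r" and ratio: "\<epsilon> < t * \<delta>"
    and core: "\<And>u. d x u \<le> \<delta> \<Longrightarrow> f x + ereal (xs (u - x)) \<le> f u + ereal \<epsilon>"
    using core_subdifferential_small_ratio[OF xs d t r] by blast
  have dual: "xs \<in> dual s" and fx: "\<bar>f x\<bar> \<noteq> \<infinity>"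
    using xs by (auto simp: core_subdifferential_def)
  then obtain a where a: "f x = ereal a" by auto
  have lin: "linear xs" and cont: "continuous_map s euclideanreal xs"
    using dual by (auto simp: dual_def)
  have xs_diff: "xs (u - x) = xs u - xs x" for u
    using lin by (rule linear_diff)
  define h where "h u = f u + ereal (- xs u)" for u
  have hx: "h x = ereal (a - xs x)" by (simp add: h_def a)
  have h_below: "ereal (a - xs x - \<epsilon>) \<le> h u" if "d x u \<le> \<delta>" for u
    using core[OF that] by (cases "f u") (auto simp: h_def a xs_diff)
  have "\<exists>y\<in>mcball x \<delta>. h y + ereal (t * d x y) \<le> h x \<and>
          (\<forall>u\<in>mcball x \<delta>. u \<noteq> y \<longrightarrow> h y < h u + ereal (t * d y u))"
  proof (rule ekeland_variational_principle[OF complete closedin_mcball])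
    show "x \<in> mcball x \<delta>" using \<delta> by simp
    show "\<bar>h x\<bar> \<noteq> \<infinity>" by (simp add: hx)
    show "lsc_at mtopology h y" if "y \<in> mcball x \<delta>" for y
      unfolding h_def s using that \<delta>
      by (intro lsc_at_diff_continuous lsc cont) (auto simp flip: s)
    show "ereal (a - xs x - \<epsilon>) \<le> h u" if "u \<in> mcball x \<delta>" for u
      using that h_below by simp
  qed (rule t)
  then obtain y where y: "d x y \<le> \<delta>" "h y + ereal (t * d x y) \<le> h x"
    and min: "\<And>u. d x u \<le> \<delta> \<Longrightarrow> u \<noteq> y \<Longrightarrow> h y < h u + ereal (t * d y u)" by auto
  have "h y \<noteq> \<infinity>" "h y \<noteq> -\<infinity>" using y h_below[OF y(1)] by (auto simp: hx)
  then obtain q where fy: "f y = ereal q" by (cases "f y") (auto simp: h_def)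
  have hy: "h y = ereal (q - xs y)" by (simp add: h_def fy)
  have decrease: "q - xs y + t * d x y \<le> a - xs x" using y(2) by (simp add: hx hy)
  have increase: "a - xs x - \<epsilon> \<le> q - xs y" using h_below[OF y(1)] by (simp add: hy)
  have "t * d x y < t * \<delta>" using decrease increase ratio by linarith
  then have interior: "d x y < \<delta>" using t by simp
  define k where "k u = f u + ereal (- xs u) + ereal (t * d u y)" for u
  have "local_minimum_at s k y"
    unfolding local_minimum_at_def
  proof (intro exI conjI ballI)
    show "openin s (mball x \<delta>)" using openin_mball s by simp
    show "y \<in> mball x \<delta>" using interior by simp
    fix u assume "u \<in> mball x \<delta>"
    then show "k y \<le> k u"
      using min[of u] by (cases "u = y") (auto simp: k_def h_def commute[of u y])
  qed
  moreover have "\<bar>k y\<bar> \<noteq> \<infinity>" by (simp add: k_def fy)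
  ultimately have "(\<lambda>u. 0) \<in> subdiff k y" by (rule fermat)
  also have "\<dots> \<subseteq> {\<lambda>u. g u + - xs u + t * m u | g m. g \<in> subdiff f y \<and> m \<in> M}"
    unfolding k_def using y(1) \<delta> uminus_in_dual[OF dual] by (intro perturb) auto
  finally obtain g m where gm: "(\<lambda>u. 0) = (\<lambda>u. g u + - xs u + t * m u)" "g \<in> subdiff f y" "m \<in> M"
    by blast
  have "g = (\<lambda>u. xs u - t * m u)"
    using fun_cong[OF gm(1)] by (auto simp: fun_eq_iff algebra_simps)
  moreover have "\<bar>q - (a + xs (y - x))\<bar> \<le> t"
  proof -
    have "0 \<le> t * d x y" using t by simp
    then show ?thesis using decrease increase \<epsilon> unfolding xs_diff by linarith
  qed
  ultimately show ?thesis
    using interior \<delta> gm a fy by (intro exI[of _ y] exI[of _ m]) auto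
qed

section \<open>Passage to the limit\<close>

lemma directed_preorder_nat: "directed_preorder (UNIV :: nat set) (\<le>)"
  unfolding directed_preorder_def by simp (metis max.cobounded1 max.cobounded2)

lemma net_converges_sequence_iff:
  "net_converges \<tau> (UNIV :: nat set) (\<le>) z p \<longleftrightarrow> limitin \<tau> z p sequentially"
  unfolding net_converges_def limitin_def eventually_sequentially
  by (simp only: bex_UNIV ball_UNIV)

theorem theorem3:
  fixes s :: "'a::real_vector topology"
    and d :: "'a \<Rightarrow> 'a \<Rightarrow> real"
    and \<mu> :: "('a \<Rightarrow> real) topology"
    and subdiff :: "('a \<Rightarrow> ereal) \<Rightarrow> 'a \<Rightarrow> ('a \<Rightarrow> real) set"
    and x :: 'a
    and f :: "'a \<Rightarrow> ereal"
  assumes "tvs s"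
    and "metrizable_space s"
    and "Metric_space UNIV d"
    and "Metric_space.mtopology UNIV d = s"
    and "Metric_space.mcomplete UNIV d"
    and "linear_dual_topology s \<mu>"
    and "\<And>h y. subdiff h y \<subseteq> dual s"
    and "\<And>h x0. local_minimum_at s h x0 \<Longrightarrow> \<bar>h x0\<bar> \<noteq> \<infinity> \<Longrightarrow> (\<lambda>u. 0) \<in> subdiff h x0"
    and "f \<in> S_class s d \<mu> subdiff x"
  shows "core_subdifferential s d f x \<subseteq> outer_limit s \<mu> (subdiff f) f x"
proof
  fix xs assume xs: "xs \<in> core_subdifferential s d f x"
  interpret Metric_space UNIV d by (rule assms(3))
  have dual: "xs \<in> dual s" using xs by (simp add: core_subdifferential_def)
  have top_\<mu>: "topspace \<mu> = dual s"
    using assms(6) by (simp add: linear_dual_topology_def linear_topology_def)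
  obtain M V where MV: "dual_bounded s \<mu> M \<and> (\<exists>U. openin s U \<and> x \<in> U \<and> U \<subseteq> V) \<and>
      (\<forall>y\<in>V. lsc_at s f y) \<and>
      (\<forall>y\<in>V. \<forall>t\<ge>0. \<forall>zs\<in>dual s.
        subdiff (\<lambda>u. f u + ereal (zs u) + ereal (t * d u y)) y
          \<subseteq> {\<lambda>u. g u + zs u + t * m u | g m. g \<in> subdiff f y \<and> m \<in> M})"
    using assms(9) unfolding S_class_def mem_Collect_eq by (elim exE) (rule that)
  note M = MV[THEN conjunct1]
    and lsc = MV[THEN conjunct2, THEN conjunct2, THEN conjunct1, rule_format]
    and perturb = MV[THEN conjunct2, THEN conjunct2, THEN conjunct2, rule_format]
  obtain U where U: "openin s U" "x \<in> U" "U \<subseteq> V"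
    using MV[THEN conjunct2, THEN conjunct1] by (elim exE conjE) (rule that)
  obtain R where R: "R > 0" "mball x R \<subseteq> U"
    using U(1,2) unfolding assms(4)[symmetric] openin_mtopology by blast
  define t :: "nat \<Rightarrow> real" where "t n = inverse (real (Suc n))" for n
  have t_pos: "t n > 0" for n by (simp add: t_def)
  have t_lim: "t \<longlonglongrightarrow> 0" unfolding t_def by (rule LIMSEQ_inverse_real_of_nat)
  have "\<forall>n. \<exists>y m. d x y < min (t n) (R / 2) \<and> m \<in> M \<and> (\<lambda>u. xs u - t n * m u) \<in> subdiff f y \<and>
          \<bar>f x\<bar> \<noteq> \<infinity> \<and> \<bar>f y\<bar> \<noteq> \<infinity> \<and>
          \<bar>real_of_ereal (f y) - (real_of_ereal (f x) + xs (y - x))\<bar> \<le> t n"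
  proof (rule allI, rule subgradient_near_core_subgradient[OF assms(3,4,5,8) xs t_pos])
    fix n
    \<comment> \<open>Half of \<open>R\<close>, so that the closed ball lies in the open ball of radius \<open>R\<close>.\<close>
    show "min (t n) (R / 2) > 0" using t_pos R by simp
    have V: "y \<in> V" if "d x y \<le> min (t n) (R / 2)" for y
      using that R U by (auto simp: subset_iff)
    show "lsc_at s f y" if "d x y \<le> min (t n) (R / 2)" for y
      using lsc V that by blast
    show "subdiff (\<lambda>u. f u + ereal (zs u) + ereal (t n * d u y)) y
          \<subseteq> {\<lambda>u. g u + zs u + t n * m u | g m. g \<in> subdiff f y \<and> m \<in> M}"
      if "d x y \<le> min (t n) (R / 2)" "zs \<in> dual s" for y zs
      using V[OF that(1)] less_imp_le[OF t_pos] that(2) by (rule perturb)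
  qed
  then obtain y m where "\<And>n. d x (y n) < min (t n) (R / 2) \<and> m n \<in> M \<and>
      (\<lambda>u. xs u - t n * m n u) \<in> subdiff f (y n) \<and> \<bar>f x\<bar> \<noteq> \<infinity> \<and> \<bar>f (y n)\<bar> \<noteq> \<infinity> \<and>
      \<bar>real_of_ereal (f (y n)) - (real_of_ereal (f x) + xs (y n - x))\<bar> \<le> t n"
    unfolding choice_iff by (elim exE) (rule that, erule spec)
  then have near: "\<And>n. d x (y n) < t n" and m: "\<And>n. m n \<in> M"
    and sub: "\<And>n. (\<lambda>u. xs u - t n * m n u) \<in> subdiff f (y n)"
    and fin: "\<bar>f x\<bar> \<noteq> \<infinity>" "\<And>n. \<bar>f (y n)\<bar> \<noteq> \<infinity>"
    and val: "\<And>n. \<bar>real_of_ereal (f (y n)) - (real_of_ereal (f x) + xs (y n - x))\<bar> \<le> t n"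
    by simp_all
  have y_lim: "limitin s y x sequentially"
    unfolding assms(4)[symmetric] limitin_metric_dist_null
  proof (intro conjI)
    show "(\<lambda>n. d (y n) x) \<longlonglongrightarrow> 0"
      using near by (intro tendsto_sandwich[OF _ _ tendsto_const t_lim])
        (auto simp: commute[of _ x] intro!: always_eventually less_imp_le)
  qed auto
  have sub_lim: "limitin \<mu> (\<lambda>n u. xs u - t n * m n u) xs sequentially"
    unfolding limitin_def
  proof (intro conjI allI impI)
    show "xs \<in> topspace \<mu>" using dual top_\<mu> by simp
    fix W assume "openin \<mu> W \<and> xs \<in> W"
    then obtain \<tau> where \<tau>: "\<tau> > 0"
      "\<And>t m. 0 < t \<Longrightarrow> t < \<tau> \<Longrightarrow> m \<in> M \<Longrightarrow> (\<lambda>u. xs u - t * m u) \<in> W"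
      using small_multiples_of_bounded_stay_near[OF assms(6) M] by metis
    have "eventually (\<lambda>n. t n < \<tau>) sequentially"
      using t_lim \<tau>(1) by (rule order_tendstoD)
    then show "eventually (\<lambda>n. (\<lambda>u. xs u - t n * m n u) \<in> W) sequentially"
      by eventually_elim (use \<tau>(2) t_pos m in blast)
  qed
  have val_lim: "(\<lambda>n. f (y n)) \<longlonglongrightarrow> f x"
  proof -
    have "limitin euclideanreal (\<lambda>n. xs (y n)) (xs x) sequentially"
      using dual y_lim continuous_map_limit[of s euclideanreal xs y x sequentially]
      by (simp add: dual_def o_def)
    then have "(\<lambda>n. xs (y n) - xs x) \<longlonglongrightarrow> xs x - xs x"
      by (intro tendsto_intros) simp
    moreover have "xs (u - x) = xs u - xs x" for u
      using dual by (intro linear_diff) (simp add: dual_def)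
    ultimately have "(\<lambda>n. xs (y n - x)) \<longlonglongrightarrow> 0" by simp
    then have "(\<lambda>n. real_of_ereal (f x) + xs (y n - x)) \<longlonglongrightarrow> real_of_ereal (f x) + 0"
      by (intro tendsto_intros)
    moreover have "(\<lambda>n. real_of_ereal (f (y n)) - (real_of_ereal (f x) + xs (y n - x))) \<longlonglongrightarrow> 0"
      using val by (intro Lim_null_comparison[OF _ t_lim]) auto
    ultimately have "(\<lambda>n. real_of_ereal (f (y n))) \<longlonglongrightarrow> real_of_ereal (f x)"
      using tendsto_add by fastforce
    then have "(\<lambda>n. ereal (real_of_ereal (f (y n)))) \<longlonglongrightarrow> ereal (real_of_ereal (f x))"
      by (rule tendsto_ereal)
    then show ?thesis using fin by (simp add: ereal_real')
  qed
  have "outer_net s \<mu> (subdiff f) f x xs UNIV (\<le>) y (\<lambda>n u. xs u - t n * m n u)"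
    unfolding outer_net_def net_converges_sequence_iff
    using directed_preorder_nat sub y_lim sub_lim val_lim by simp
  then show "xs \<in> outer_limit s \<mu> (subdiff f) f x"
    by (rule outer_net_imp_outer_limit)
qed

end
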